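(* Let $n$ be an even positive integer with $\frac{n}{2}$ odd, and let $S=\{x\in\mathbb{F}_{2^n}: x^{-2}=x^{-1}+1\}$. Then $S=\{\omega,\omega^2\}$, where $\omega$ is a primitive third root of unity, and the function $f(x)=x^{-1}+\delta_S(x)$ is a differentially 4-uniform permutation over $\mathbb{F}_{2^n}$.
   Context: The convention $0^{-1}=0$ is used, so $x^{-1}=x^{2^n-2}$ on $\mathbb{F}_{2^n}$, and $x^{-2}=(x^{-1})^2$. For $S\subseteq\mathbb{F}_{2^n}$, $\delta_S:\mathbb{F}_{2^n}\to\mathbb{F}_2\subseteq\mathbb{F}_{2^n}$ is the characteristic function: $\delta_S(x)=1$ if $x\in S$ and $\delta_S(x)=0$ otherwise. For $f:\mathbb{F}_{2^n}\to\mathbb{F}_{2^n}$, the differential uniformity is $\Delta_f=\max\{N(a,b): a,b\in\mathbb{F}_{2^n}, a\neq 0\}$, where $N(a,b)$ is the number of $x\in\mathbb{F}_{2^n}$ with $f(x+a)+f(x)=b$. $f$ is differentially 4-uniform if $\Delta_f=4$. *)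

theory Defs
  imports
    Complex_Main
    "HOL-Library.Cardinality"
    "HOL-Library.Indicator_Function"
begin

definition primitive_root_of_unity :: "nat \<Rightarrow> 'a::field \<Rightarrow> bool" where
  "primitive_root_of_unity k w \<longleftrightarrow> k > 0 \<and> w ^ k = 1 \<and> (\<forall>j. 0 < j \<and> j < k \<longrightarrow> w ^ j \<noteq> 1)"

definition diff_count :: "('a::{field,finite} \<Rightarrow> 'a) \<Rightarrow> 'a \<Rightarrow> 'a \<Rightarrow> nat" where
  "diff_count f a b = card {x. f (x + a) + f x = b}"

(* The differential is written with + as is usual in characteristic 2;
   these notions are intended for fields of order 2^n only. *)
definition differential_uniformity :: "('a::{field,finite} \<Rightarrow> 'a) \<Rightarrow> nat" where
  "differential_uniformity f = Max {diff_count f a b | a b. a \<noteq> 0}"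

definition differentially_uniform :: "nat \<Rightarrow> ('a::{field,finite} \<Rightarrow> 'a) \<Rightarrow> bool" where
  "differentially_uniform k f \<longleftrightarrow> differential_uniformity f = k"

end

theory Submission
  imports Defs "HOL-Computational_Algebra.Polynomial" "HOL-Number_Theory.Cong"
begin

text \<open>
  On \<open>S = {\<omega>, \<omega>\<^sup>2}\<close> inversion swaps the two points, so \<open>f\<close> fixes both of them and is an
  involution. An equation \<open>f (x + a) + f x = b\<close> either has \<open>x\<close> and \<open>x + a\<close>
  both outside \<open>S\<close> (or \<open>a = 1\<close>), and then is the equation \<open>inverse (x + a) + inverse x = b\<close>, with
  at most four solutions and at most two if \<open>b \<noteq> 1 / a\<close>; or \<open>x\<close> lies in one of the pairs
  \<open>{\<omega>, \<omega> + a}\<close>, \<open>{\<omega>\<^sup>2, \<omega>\<^sup>2 + a}\<close>, each tied to a single value of \<open>b\<close>. Every way for more than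
  four solutions to accumulate forces a root of \<open>y\<^sup>2 + y = \<omega>\<close> or of its conjugate. Such a \<open>y\<close>
  satisfies \<open>y ^ 4 = y + 1\<close>, and \<open>n / 2\<close> iterations give \<open>y ^ (2 ^ n) = y + 1\<close> as \<open>n / 2\<close> is odd,
  contradicting \<open>y ^ (2 ^ n) = y\<close>.
\<close>

section \<open>Finite fields of even order: characteristic, Frobenius map, cube roots of
  unity\<close>

lemma two_eq_zero_if_CARD_power_two:
  assumes "CARD('a::{field,finite}) = 2 ^ n"
  shows "(2::'a) = 0"
proof -
  \<comment> \<open>Translation by 1 permutes the field, so comparing both sums shows that the field
    order is 0 in the field.\<close>
  have "(\<Sum>x\<in>UNIV. x) = (\<Sum>x\<in>UNIV. x + (1::'a))"
    by (rule sum.reindex_bij_witness[of _ "\<lambda>x. x + 1" "\<lambda>x. x - 1"]) auto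
  then have "(of_nat (CARD('a)) :: 'a) = 0"
    by (simp add: sum.distrib)
  then show ?thesis
    using assms by simp
qed

lemma char_2_simps:
  fixes u v :: "'a::comm_ring_1"
  assumes "(2::'a) = 0"
  shows "u + u = 0" and "u + (u + v) = v" and "- u = u" and "u - v = u + v"
    and "u + v = 0 \<longleftrightarrow> u = v"
proof -
  show *: "u + u = 0" for u :: 'a
    using assms by (simp flip: mult_2)
  show "u + (u + v) = v"
    by (simp add: * flip: add.assoc)
  show **: "- u = u" for u :: 'a
    using * by (rule minus_unique)
  show "u - v = u + v"
    by (simp add: ** flip: add_uminus_conv_diff)
  show "u + v = 0 \<longleftrightarrow> u = v"
    by (auto simp: ** add_eq_0_iff)
qed

text \<open>Multiplication by \<open>x\<close> permutes the nonzero elements, whose product can be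
  cancelled.\<close>

lemma power_CARD_minus_one:
  fixes x :: "'a::{field,finite}"
  assumes "x \<noteq> 0"
  shows "x ^ (CARD('a) - 1) = 1"
proof -
  let ?U = "UNIV - {0::'a}"
  have "(\<Prod>y\<in>?U. y) = (\<Prod>y\<in>?U. x * y)"
    by (rule prod.reindex_bij_witness[of _ "\<lambda>y. x * y" "\<lambda>y. y / x"]) (use assms in auto)
  also have "\<dots> = x ^ (CARD('a) - 1) * (\<Prod>y\<in>?U. y)"
    by (simp add: prod.distrib card_Diff_singleton)
  finally show ?thesis
    by simp
qed

lemma power_CARD:
  fixes x :: "'a::{field,finite}"
  shows "x ^ CARD('a) = x"
proof (cases "x = 0")
  case False
  have "x ^ CARD('a) = x * x ^ (CARD('a) - 1)"
    by (metis One_nat_def power_eq_if zero_less_card_finite less_numeral_extra(3))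
  then show ?thesis
    using power_CARD_minus_one[OF False] by simp
qed simp

text \<open>As \<open>n\<close> is even, 3 divides the order \<open>3 * m\<close> of the
  multiplicative group. The polynomial \<open>X ^ m - 1\<close> has at most \<open>m\<close> roots,
  so some nonzero \<open>x\<close> is not a root, and \<open>x ^ m\<close> is a nontrivial cube root
  of unity.\<close>

lemma ex_cube_root_of_unity:
  assumes "CARD('a::{field,finite}) = 2 ^ n" and "n > 0" and "even n"
  shows "\<exists>w::'a. w\<^sup>2 = w + 1"
proof -
  define m where "m = (CARD('a) - 1) div 3"
  obtain k where k: "n = 2 * k"
    using \<open>even n\<close> by blast
  have "[(4::nat) ^ k = 1 ^ k] (mod 3)"
    by (rule cong_pow) (simp add: cong_def)
  then have "3 dvd CARD('a) - 1"
    using assms(1) k by (simp add: power_mult cong_altdef_nat)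
  then have m: "CARD('a) - 1 = 3 * m"
    by (simp add: m_def)
  have "CARD('a) \<ge> 2 ^ 1"
    unfolding assms(1) using \<open>n > 0\<close> by (intro power_increasing) auto
  then have "m > 0"
    using m by (intro Nat.gr0I) auto
  define p :: "'a poly" where "p = monom 1 m - 1"
  have "degree p \<le> m"
    unfolding p_def by (intro degree_diff_le) (auto simp: degree_monom_le)
  moreover have "coeff p m = 1"
    using \<open>m > 0\<close> by (simp add: p_def)
  then have "p \<noteq> 0"
    by auto
  ultimately have "card {x. poly p x = 0} \<le> m"
    using card_poly_roots_bound[of p] by linarith
  then have "\<not> UNIV - {0} \<subseteq> {x. poly p x = 0}"
    using card_mono[of "{x. poly p x = 0}" "UNIV - {0}"] m \<open>m > 0\<close>
    by (auto simp: card_Diff_singleton)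
  then obtain x where "x \<noteq> 0" and "poly p x \<noteq> 0"
    by blast
  then have x: "x \<noteq> 0" "x ^ m \<noteq> 1"
    by (simp_all add: p_def poly_monom)
  define w where "w = x ^ m"
  have "w ^ 3 = 1"
    using power_CARD_minus_one[OF x(1)] m
    by (simp add: w_def mult.commute flip: power_mult)
  then have "(w - 1) * (w\<^sup>2 + w + 1) = 0"
    by (simp add: power2_eq_square power3_eq_cube algebra_simps)
  then have "w\<^sup>2 + (w + 1) = 0"
    using x(2) by (simp add: w_def add.assoc)
  then show ?thesis
    using char_2_simps(5)[OF two_eq_zero_if_CARD_power_two[OF assms(1)]] by blast
qed

text \<open>This is the shape in which the obstruction arises from the difference equations;
  rescaling \<open>y\<close> turns it into the equation \<open>z ^ 2 = z + w\<close>.\<close>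

lemma no_root_of_quadratic:
  fixes w y :: "'a::{field,finite}"
  assumes card: "CARD('a) = 2 ^ n" and "even n" "odd (n div 2)" and w: "w\<^sup>2 = w + 1"
  shows "y\<^sup>2 \<noteq> w * y + 1"
proof
  assume y: "y\<^sup>2 = w * y + 1"
  note two = two_eq_zero_if_CARD_power_two[OF card]
  note ch = char_2_simps[OF two] distrib_left distrib_right ac_simps
  \<comment> \<open>\<open>w ^ 2\<close> is the inverse of \<open>w\<close>, so \<open>z\<close> is
    \<open>y / w\<close>.\<close>
  define z where "z = w\<^sup>2 * y"
  have "(w\<^sup>2)\<^sup>2 = w"
    using w by (simp add: ch power2_eq_square)
  then have "z\<^sup>2 = w * (w * y + 1)"
    by (simp add: z_def power_mult_distrib y)
  then have z2: "z\<^sup>2 = z + w"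
    by (simp add: z_def power2_eq_square distrib_left mult.assoc)
  have "z ^ 4 = (z + w)\<^sup>2"
    using power_mult[of z 2 2] by (simp add: z2)
  also have "\<dots> = z\<^sup>2 + w\<^sup>2"
    by (simp add: ch power2_eq_square)
  finally have z4: "z ^ 4 = z + 1"
    by (simp add: ch z2 w)
  \<comment> \<open>Raising to the fourth power is additive and fixes the prime field, so each
    iteration adds 1 to \<open>z\<close>.\<close>
  have "z ^ (4 ^ k) = z + of_nat k" for k
  proof (induction k)
    case (Suc k)
    have "(of_nat k :: 'a) = of_bool (odd k)"
      using two by (cases "even k") (auto elim!: evenE oddE)
    then have k: "(of_nat k :: 'a) ^ 4 = of_nat k"
      by simp
    have "z ^ (4 ^ Suc k) = (z + of_nat k) ^ 4"
      by (simp add: Suc.IH mult.commute[of 4] power_mult)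
    also have "\<dots> = z ^ 4 + of_nat k ^ 4"
      by (simp add: ch power4_eq_xxxx)
    finally show ?case
      using z4 k by (simp add: ch)
  qed simp
  \<comment> \<open>Since \<open>n\<close> is even, \<open>4 ^ (n div 2)\<close> is the order of the
    field, and that power fixes \<open>z\<close>.\<close>
  from this[of "n div 2"] have "z = z + of_nat (n div 2)"
    using power_CARD[of z] card \<open>even n\<close>
    by (metis dvd_mult_div_cancel num_double numeral_times_numeral power2_eq_square power_mult)
  moreover have "(of_nat (n div 2) :: 'a) = 1"
    using \<open>odd (n div 2)\<close> two by (auto elim!: oddE)
  ultimately show False
    by simp
qed

section \<open>The difference equation of inversion\<close>

lemma card_quadratic_le:
  fixes a c :: "'a::{field,finite}"
  shows "card {x. x * (x + a) = c} \<le> 2"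
proof (cases "\<exists>r. r * (r + a) = c")
  case True
  then obtain r where r: "r * (r + a) = c" ..
  have "x = r \<or> x = - r - a" if "x * (x + a) = c" for x
  proof -
    have "(x - r) * (x - (- r - a)) = 0"
      using that r by (simp add: algebra_simps)
    then show ?thesis
      by simp
  qed
  then have "{x. x * (x + a) = c} \<subseteq> {r, - r - a}"
    by blast
  then show ?thesis
    by (rule order.trans[OF card_mono, rotated]) (auto simp: card_insert_if)
qed auto

text \<open>Multiplying by \<open>x * (x + a)\<close> clears denominators and leaves
  \<open>x + (x + a) = a\<close> on one side. The points 0 and \<open>a\<close>, where this fails,
  are governed by \<open>inverse 0 = 0\<close>.\<close>

lemma inverse_diff_eq:
  fixes a b x :: "'a::field"
  assumes "(2::'a) = 0" and "inverse (x + a) + inverse x = b"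
  shows "x = 0 \<and> b = inverse a \<or> x = a \<and> b = inverse a \<or>
    x \<noteq> 0 \<and> x \<noteq> a \<and> b * (x * (x + a)) = a"
proof -
  note ch = char_2_simps[OF assms(1)]
  consider "x = 0" | "x = a" "a \<noteq> 0" | "x \<noteq> 0" "x \<noteq> a"
    by blast
  then show ?thesis
  proof cases
    case 2
    then show ?thesis
      using assms(2) by (simp add: ch)
  next
    case 3
    then have "x + a \<noteq> 0"
      by (simp add: ch)
    then have "b * (x * (x + a)) = x + (x + a)"
      using 3 by (simp add: distrib_right mult.assoc[symmetric] flip: assms(2))
    then show ?thesis
      using 3 by (simp add: ch)
  qed (use assms(2) in auto)
qed

lemma card_quadratic_scaled_le:
  fixes a b :: "'a::{field,finite}"
  assumes "a \<noteq> 0"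
  shows "card {x. b * (x * (x + a)) = a} \<le> 2"
proof -
  \<comment> \<open>For \<open>b = 0\<close> the left-hand set is empty because \<open>a\<close> is
    nonzero, so the default value of \<open>a / b\<close> is harmless.\<close>
  have "{x. b * (x * (x + a)) = a} \<subseteq> {x. x * (x + a) = a / b}"
    using assms by (auto simp: eq_divide_eq mult.commute)
  from card_mono[OF _ this] card_quadratic_le[of a "a / b"] show ?thesis
    by simp
qed

lemma card_pair_Un_quadratic_le:
  fixes a b u v :: "'a::{field,finite}"
  assumes "a \<noteq> 0"
  shows "card ({u, v} \<union> {x. b * (x * (x + a)) = a}) \<le> 4"
proof -
  have "card {u, v} \<le> 2"
    by (simp add: card_insert_if)
  then show ?thesis
    using card_Un_le[of "{u, v}" "{x. b * (x * (x + a)) = a}"]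
      card_quadratic_scaled_le[OF assms, of b] by linarith
qed

lemma diff_count_inverse_le:
  fixes a b :: "'a::{field,finite}"
  assumes "(2::'a) = 0" and "a \<noteq> 0"
  shows "diff_count inverse a b \<le> 4"
proof -
  have "{x. inverse (x + a) + inverse x = b} \<subseteq> {0, a} \<union> {x. b * (x * (x + a)) = a}"
    using inverse_diff_eq[OF assms(1)] by auto
  from card_mono[OF _ this] card_pair_Un_quadratic_le[OF assms(2), of 0 a b] show ?thesis
    by (simp add: diff_count_def)
qed

section \<open>Differences of the modified inverse\<close>

text \<open>Inversion already has two pairs of solutions for \<open>b = 1 / a\<close>; this keeps the exceptional pair
  \<open>{w, w + a}\<close> from adding a third.\<close>

lemma exceptional_value_neq_inverse:
  fixes a w :: "'a::field"
  assumes two: "(2::'a) = 0" and w: "w\<^sup>2 = w + 1" and "a \<noteq> 0"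
    and no_root: "\<And>y. y\<^sup>2 \<noteq> w * y + 1"
  shows "inverse (w + a) + w \<noteq> inverse a"
proof
  note ch = char_2_simps[OF two] distrib_left distrib_right ac_simps
  assume *: "inverse (w + a) + w = inverse a"
  show False
  \<comment> \<open>Here \<open>inverse 0 = 0\<close> reduces the assumed equation to
    \<open>w = inverse w\<close>.\<close>
  proof (cases "w + a = 0")
    case True
    then have "w = a"
      by (simp add: ch)
    then have "w * w = 1"
      using * \<open>a \<noteq> 0\<close> by (metis ch(1) add_0 inverse_zero right_inverse)
    then have "w = 0"
      using w by (simp add: power2_eq_square)
    with w show False
      by simp
  next
    case False
    then have eq: "a + w * (a * (w + a)) = w + a"
      using * \<open>a \<noteq> 0\<close> by (auto simp: field_simps)
    \<comment> \<open>The sum equals \<open>w * (a ^ 2 + w * a + 1)\<close>, and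
      \<open>w + 1\<close> is the inverse of \<open>w\<close>.\<close>
    have "(w + 1) * ((a + w * (a * (w + a))) + (w + a)) = 0"
      unfolding eq by (simp only: ch(1) mult_zero_right)
    also have "(w + 1) * ((a + w * (a * (w + a))) + (w + a)) = a\<^sup>2 + (w * a + 1)"
    proof -
      have "w * w = w + 1" "w * (w * u) = w * u + u" for u
        using w by (simp_all add: power2_eq_square distrib_right flip: mult.assoc)
      then show ?thesis
        by (simp add: ch power2_eq_square)
    qed
    finally have "a\<^sup>2 = w * a + 1"
      by (simp only: ch(5))
    with no_root show False
      by blast
  qed
qed

text \<open>Determines when both exceptional pairs can serve the same \<open>b\<close>. If both
  \<open>p = w + a\<close> and \<open>q = w + 1 + a\<close> are nonzero, clearing denominators gives
  \<open>p + q + p * q = 0\<close>, which is \<open>a * (a + 1) = 0\<close>.\<close>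

lemma exceptional_values_eq:
  fixes a w :: "'a::field"
  assumes two: "(2::'a) = 0" and w: "w\<^sup>2 = w + 1" and "a \<noteq> 0" "a \<noteq> 1"
    and eq: "inverse (w + a) + w = inverse (w + 1 + a) + (w + 1)"
  shows "a = w \<or> a = w + 1"
proof (rule ccontr)
  note ch = char_2_simps[OF two] distrib_left distrib_right ac_simps
  assume *: "\<not> ?thesis"
  define p q where "p = w + a" and "q = w + 1 + a"
  have "p \<noteq> 0" "q \<noteq> 0"
    using * by (auto simp: char_2_simps[OF two] p_def q_def)
  have "inverse p + w = inverse q + (w + 1)"
    using eq by (simp add: p_def q_def)
  then have "p * q * inverse p + p * q * w = p * q * inverse q + p * q * (w + 1)"
    by (metis distrib_left)
  moreover have "p * q * inverse p = q" "p * q * inverse q = p"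
    using \<open>p \<noteq> 0\<close> \<open>q \<noteq> 0\<close> by auto
  ultimately have "q + w * p * q = p + (w + 1) * p * q"
    by (metis mult.assoc mult.commute)
  then have "q + w * p * q + (p + (w + 1) * p * q) = 0"
    by (simp add: ch(1))
  also have "q + w * p * q + (p + (w + 1) * p * q) = p + q + p * q"
    by (simp add: ch)
  also have "\<dots> = a * (a + 1)"
    by (simp add: p_def q_def ch w[unfolded power2_eq_square])
  finally show False
    using \<open>a \<noteq> 0\<close> \<open>a \<noteq> 1\<close> by (simp add: ch(5))
qed

text \<open>For \<open>a \<noteq> 1\<close> the cases are: \<open>b = inverse a\<close>, where only
  solutions for inversion remain; both exceptional pairs present, where the quadratic has no root;
  and at most one pair, joined by at most two roots.\<close>

lemma diff_count_modified_le:
  fixes a b w :: "'a::{field,finite}"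
  defines "f \<equiv> \<lambda>x. inverse x + indicator {w, w + 1} x"
  assumes two: "(2::'a) = 0" and w: "w\<^sup>2 = w + 1" and a: "a \<noteq> 0"
    and nr: "\<And>y. y\<^sup>2 \<noteq> w * y + 1" and nr': "\<And>y. y\<^sup>2 \<noteq> (w + 1) * y + 1"
  shows "diff_count f a b \<le> 4"
proof -
  note ch = char_2_simps[OF two] distrib_left distrib_right ac_simps
  have w': "(w + 1)\<^sup>2 = (w + 1) + 1"
    using w by (simp add: ch power2_eq_square)
  have inv: "inverse w = w + 1" "inverse (w + 1) = w"
    by (rule inverse_unique, simp add: ch w[unfolded power2_eq_square])+
  have aa: "x + a + a = x" for x
    by (simp add: ch)
  have fw: "f w = w" "f (w + 1) = w + 1"
    using inv by (simp_all add: f_def ch)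
  have fo: "f x = inverse x" if "x \<noteq> w" "x \<noteq> w + 1" for x
    using that by (simp add: f_def)
  \<comment> \<open>For \<open>a\<close> other than 0 and 1, these are the differences of
    \<open>f\<close> on the pairs \<open>{w, w + a}\<close> and
    \<open>{w + 1, w + 1 + a}\<close>.\<close>
  define b1 b2 where "b1 = inverse (w + a) + w" and "b2 = inverse (w + 1 + a) + (w + 1)"
  let ?D = "{x. f (x + a) + f x = b}"
  let ?I = "{x. inverse (x + a) + inverse x = b}"
  let ?Q = "{x. b * (x * (x + a)) = a}"
  show ?thesis
  proof (cases "a = 1")
    case True
    \<comment> \<open>Translation by 1 swaps \<open>w\<close> and \<open>w + 1\<close>, so the two
      indicator terms cancel.\<close>
    have "f (x + a) + f x = inverse (x + a) + inverse x" for x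
    proof -
      have "x + 1 = w \<longleftrightarrow> x = w + 1"
        by (auto simp: ch)
      then have "indicator {w, w + 1} (x + 1) = (indicator {w, w + 1} x :: 'a)"
        by (auto simp: indicator_def)
      then show ?thesis
        using True by (simp add: f_def ch)
    qed
    then show ?thesis
      using diff_count_inverse_le[OF two a, of b] by (simp add: diff_count_def)
  next
    case False
    have off: "w + a \<noteq> w" "w + a \<noteq> w + 1" "w + 1 + a \<noteq> w" "w + 1 + a \<noteq> w + 1"
      using a False ch(5)[of 1 a] by (auto simp: add.assoc)
    have cases: "x \<in> {w, w + a} \<and> b = b1 \<or> x \<in> {w + 1, w + 1 + a} \<and> b = b2 \<or> x \<in> ?I"
      if "x \<in> ?D" for x
    proof -
      have *: "f (x + a) + f x = b"
        using that by simp
      consider "x = w" | "x = w + 1" | "x + a = w" | "x + a = w + 1"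
        | "x \<noteq> w" "x \<noteq> w + 1" "x + a \<noteq> w" "x + a \<noteq> w + 1"
        by blast
      then show ?thesis
      proof cases
        case 1
        then show ?thesis
          using * off by (simp add: fw fo b1_def)
      next
        case 2
        then show ?thesis
          using * off by (simp add: fw fo b2_def)
      next
        case 3
        then have "x = w + a"
          using aa by metis
        then show ?thesis
          using * off aa[of w] fw(1) fo[of "w + a"]
          by (simp add: b1_def add.commute[of w "inverse _"])
      next
        case 4
        then have "x = w + 1 + a"
          using aa by metis
        then show ?thesis
          using * off aa[of "w + 1"] fw(2) fo[of "w + 1 + a"]
          by (simp add: b2_def add.commute[of "w + 1" "inverse _"])
      next
        case 5
        then show ?thesis
          using * by (simp add: fo)
      qed
    qed
    have I: "?I \<subseteq> ?Q" if "b \<noteq> inverse a"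
      using inverse_diff_eq[OF two] that by blast
    have b1: "b1 \<noteq> inverse a" and b2: "b2 \<noteq> inverse a"
      unfolding b1_def b2_def
      using exceptional_value_neq_inverse[OF two w a nr]
        exceptional_value_neq_inverse[OF two w' a nr'] by blast+
    consider "b = inverse a" | "b \<noteq> inverse a" "b = b1" "b = b2"
      | "b \<noteq> inverse a" "b \<noteq> b1" | "b \<noteq> inverse a" "b \<noteq> b2"
      by blast
    then show ?thesis
    proof cases
      case 1
      then have "?D \<subseteq> ?I"
        using cases b1 b2 by blast
      from card_mono[OF _ this] diff_count_inverse_le[OF two a, of b] show ?thesis
        by (simp add: diff_count_def)
    next
      case 2
      then consider "a = w" | "a = w + 1"
        using exceptional_values_eq[OF two w a False] by (auto simp: b1_def b2_def)
      \<comment> \<open>One of the two inverses is \<open>inverse 0 = 0\<close>, whence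
        \<open>b = a\<close>. The quadratic then reads \<open>x ^ 2 = a * x + 1\<close>, which
        \<open>nr\<close> or \<open>nr'\<close> excludes.\<close>
      then have "b = a \<and> (\<forall>y. y\<^sup>2 \<noteq> a * y + 1)"
      proof cases
        case 1
        then show ?thesis
          using 2 nr by (simp add: b1_def ch(1))
      next
        case b: 2
        then show ?thesis
          using 2 nr' by (simp add: b2_def ch(1))
      qed
      moreover have "x\<^sup>2 = a * x + 1" if "a * (x * (x + a)) = a" for x
      proof -
        have "x * (x + a) = 1"
          using that a by simp
        then show ?thesis
          by (simp add: ch power2_eq_square flip: \<open>x * (x + a) = 1\<close>)
      qed
      ultimately have "?Q = {}"
        by auto
      then have "?D \<subseteq> set [w, w + a, w + 1, w + 1 + a]"
        using cases I 2 by auto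
      from card_mono[OF _ this] card_length[of "[w, w + a, w + 1, w + 1 + a]"] show ?thesis
        by (simp add: diff_count_def)
    next
      case 3
      then have "?D \<subseteq> {w + 1, w + 1 + a} \<union> ?Q"
        using cases I by blast
      from card_mono[OF _ this] card_pair_Un_quadratic_le[OF a, of "w + 1" "w + 1 + a" b]
      show ?thesis
        by (simp add: diff_count_def)
    next
      case 4
      then have "?D \<subseteq> {w, w + a} \<union> ?Q"
        using cases I by blast
      from card_mono[OF _ this] card_pair_Un_quadratic_le[OF a, of w "w + a" b]
      show ?thesis
        by (simp add: diff_count_def)
    qed
  qed
qed

section \<open>The exceptional set, the involution, and the exact differential uniformity\<close>

theorem theorem6:
  fixes n :: nat
    and S :: "'a::{field,finite} set"
    and f :: "'a \<Rightarrow> 'a"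
  assumes "CARD('a) = 2 ^ n"
    and "n > 0" and "even n" and "odd (n div 2)"
    and "S = {x. (inverse x)\<^sup>2 = inverse x + 1}"
    and "f = (\<lambda>x. inverse x + indicator S x)"
  shows "(\<exists>\<omega>. primitive_root_of_unity 3 \<omega> \<and> S = {\<omega>, \<omega>\<^sup>2}) \<and>
    bij f \<and> differentially_uniform 4 f"
proof -
  note two = two_eq_zero_if_CARD_power_two[OF assms(1)]
  obtain w :: 'a where w: "w\<^sup>2 = w + 1"
    using ex_cube_root_of_unity[OF assms(1-3)] by blast
  note ch = char_2_simps[OF two] distrib_left distrib_right ac_simps
  have w': "(w + 1)\<^sup>2 = (w + 1) + 1"
    using w by (simp add: ch power2_eq_square)
  have inv: "inverse w = w + 1" "inverse (w + 1) = w"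
    by (rule inverse_unique, simp add: ch w[unfolded power2_eq_square])+
  have ne: "w \<noteq> 0" "w \<noteq> 1" "w + 1 \<noteq> 0" "w + 1 \<noteq> 1"
    using w ch(1)[of "1::'a"] by (auto simp: ch(5))
  have S: "S = {w, w + 1}"
  proof -
    have "(inverse x)\<^sup>2 = inverse x + 1 \<longleftrightarrow> x = w \<or> x = w + 1" for x
    proof
      assume *: "(inverse x)\<^sup>2 = inverse x + 1"
      \<comment> \<open>In characteristic 2, \<open>w\<close> and \<open>w + 1\<close> are the two
        roots of \<open>t ^ 2 + t + 1\<close>.\<close>
      have "(inverse x + w) * (inverse x + (w + 1)) = 0"
        by (simp add: ch w[unfolded power2_eq_square] *[unfolded power2_eq_square])
      then have "inverse x = inverse (w + 1) \<or> inverse x = inverse w"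
        using inv by (simp add: ch(5))
      then show "x = w \<or> x = w + 1"
        by auto
    next
      assume "x = w \<or> x = w + 1"
      then show "(inverse x)\<^sup>2 = inverse x + 1"
        using inv w by (auto simp: ch(2) w' add.assoc)
    qed
    then show ?thesis
      unfolding assms(5) by auto
  qed
  have f: "f = (\<lambda>x. inverse x + indicator {w, w + 1} x)"
    using assms(6) S by simp
  have f_S: "f w = w" "f (w + 1) = w + 1"
    using inv by (simp_all add: f ch)
  have f_01: "f 0 = 0" "f 1 = 1"
    using ne by (auto simp: f indicator_def)
  have "primitive_root_of_unity 3 w"
  proof -
    have "w ^ 3 = 1"
      by (simp add: power3_eq_cube ch w[unfolded power2_eq_square])
    moreover have "w ^ j \<noteq> 1" if "0 < j" "j < 3" for j
    proof -
      have "j = 1 \<or> j = 2"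
        using that by auto
      then show ?thesis
        using ne w by auto
    qed
    ultimately show ?thesis
      by (simp add: primitive_root_of_unity_def)
  qed
  moreover have "bij f"
  proof (rule involuntory_imp_bij)
    have f_off: "f x = inverse x" if "x \<noteq> w" "x \<noteq> w + 1" for x
      using that by (simp add: f)
    show "f (f x) = x" for x
    proof (cases "x = w \<or> x = w + 1")
      case False
      then have "inverse x \<noteq> w" "inverse x \<noteq> w + 1"
        using inv by (metis inverse_inverse_eq)+
      then show ?thesis
        using False f_off by simp
    qed (use f_S in auto)
  qed
  moreover have "differential_uniformity f = 4"
    unfolding differential_uniformity_def
  proof (rule Max_eqI)
    have "{diff_count f a b | a b. a \<noteq> 0} \<subseteq> range (\<lambda>(a, b). diff_count f a b)"
      by auto
    then show "finite {diff_count f a b | a b. a \<noteq> 0}"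
      by (rule finite_subset) simp
    have le: "diff_count f a b \<le> 4" if "a \<noteq> 0" for a b
      unfolding f using that two w
        no_root_of_quadratic[OF assms(1,3,4) w] no_root_of_quadratic[OF assms(1,3,4) w']
      by (intro diff_count_modified_le) auto
    then show "k \<le> 4" if "k \<in> {diff_count f a b | a b. a \<noteq> 0}" for k
      using that by auto
    \<comment> \<open>The bound is attained at \<open>a = b = 1\<close>: \<open>f\<close> fixes all
      four elements of the subfield of order 4.\<close>
    have "{0, 1, w, w + 1} \<subseteq> {x. f (x + 1) + f x = 1}"
    proof -
      have "w + 1 + w = 1" "w + 1 + 1 = w"
        by (simp_all add: ch)
      then show ?thesis
        using two by (auto simp: f_01 f_S add.commute[of w "w + 1"])
    qed
    from card_mono[OF _ this] have "4 \<le> diff_count f 1 1"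
      using ne ne[symmetric] by (simp add: diff_count_def)
    then have "diff_count f 1 1 = 4"
      using le[of 1 1] by simp
    then show "4 \<in> {diff_count f a b | a b. a \<noteq> 0}"
      using one_neq_zero[where 'a = 'a] by (metis (mono_tags, lifting) mem_Collect_eq)
  qed
  ultimately show ?thesis
    using S w by (auto simp: differentially_uniform_def)
qed

end
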